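(* Let $a<b$ and $c<d$ be real numbers, let $\Delta=[a,b]\times[c,d]$, and suppose that $f:\Delta\to\mathbb{R}$ is J-quasi-convex on the co-ordinates on $\Delta$. If $f_x\in L_1[c,d]$ for all $x\in[a,b]$ and $f_y\in L_1[a,b]$ for all $y\in[c,d]$, then $$\frac12\left[\frac{1}{b-a}\int_a^b f\left(x,\frac{c+d}{2}\right)dx+\frac{1}{d-c}\int_c^d f\left(\frac{a+b}{2},y\right)dy\right]\le \frac{1}{(b-a)(d-c)}\int_c^d\int_a^b f(x,y)\,dx\,dy+H,$$ where $$H=\frac{1}{4(d-c)}\int_c^d\int_0^1\left|f(ta+(1-t)b,y)-f((1-t)a+tb,y)\right|dt\,dy+\frac{1}{4(b-a)}\int_a^b\int_0^1\left|f(x,tc+(1-t)d)-f(x,(1-t)c+td)\right|dt\,dx.$$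
   Context: For $f:\Delta=[a,b]\times[c,d]\to\mathbb{R}$, the partial mappings are $f_y:[a,b]\to\mathbb{R}$, $f_y(u)=f(u,y)$ for $y\in[c,d]$, and $f_x:[c,d]\to\mathbb{R}$, $f_x(v)=f(x,v)$ for $x\in[a,b]$. A function $g:I\to\mathbb{R}$ on an interval $I\subseteq\mathbb{R}$ is J-quasi-convex if $g\left(\frac{u+v}{2}\right)\le\max\{g(u),g(v)\}$ for all $u,v\in I$. The function $f$ is J-quasi-convex on the co-ordinates on $\Delta$ if all partial mappings $f_y$ ($y\in[c,d]$) and $f_x$ ($x\in[a,b]$) are J-quasi-convex.
   Formalization: The formal theorem additionally assumes that the function y ↦ ∫_a^b f(x,y) dx is Lebesgue integrable on [c,d], i.e. that the double integral is finite; without this the right-hand side can be the undefined −∞+∞. *)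

theory Defs
  imports "HOL-Analysis.Analysis"
begin

definition J_quasi_convex_on :: "real set \<Rightarrow> (real \<Rightarrow> real) \<Rightarrow> bool" where
  "J_quasi_convex_on I g \<longleftrightarrow> (\<forall>u\<in>I. \<forall>v\<in>I. g ((u + v) / 2) \<le> max (g u) (g v))"

(* A function on the rectangle {a..b} \<times> {c..d} is represented by a total function on pairs,
   whose values outside the rectangle are never used. *)
definition J_quasi_convex_on_coords ::
    "real \<Rightarrow> real \<Rightarrow> real \<Rightarrow> real \<Rightarrow> (real \<times> real \<Rightarrow> real) \<Rightarrow> bool" where
  "J_quasi_convex_on_coords a b c d f \<longleftrightarrow>
     (\<forall>y\<in>{c..d}. J_quasi_convex_on {a..b} (\<lambda>u. f (u, y))) \<and>
     (\<forall>x\<in>{a..b}. J_quasi_convex_on {c..d} (\<lambda>v. f (x, v)))"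

end

theory Submission
  imports Defs
begin

text \<open>
  In one variable the inequality is immediate: if \<open>g\<close> is J-quasi-convex on \<open>[a, b]\<close>, then
  \<open>g ((a + b) / 2) \<le> max (g x) (g (a + b - x))\<close> for every \<open>x\<close>, and writing the maximum as half of
  \<open>g x + g (a + b - x) + \<bar>g (a + b - x) - g x\<bar>\<close> and averaging over \<open>x\<close> gives
  \<open>J_quasi_convex_midpoint_le\<close>. The theorem is the mean of two such inequalities, one for the
  sections in each coordinate, each integrated over the remaining variable.

  The substance lies in this second integration. Only the sections of \<open>f\<close> are known to be
  integrable, and \<open>f\<close> need not be measurable on the rectangle, so it is not clear that the two
  iterated integrals of \<open>f\<close> agree, nor that the inner integrals in \<open>H\<close> are integrable functions of
  the outer variable. (A Bochner integral of a non-integrable function is \<open>0\<close> by convention, which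
  could destroy the inequality.) J-quasi-convexity repairs both defects.

  Measurability. A measurable midpoint-convex set of reals is either null or convex
  (\<open>midpoint_convex_negligible_or_convex\<close>). Applied to sublevel sets, this has two consequences.
  First, a supremum of an arbitrary, possibly uncountable, family of measurable J-quasi-convex
  functions is measurable, because its sublevel sets are intersections of sets that are null or
  convex. Second, a measurable J-quasi-convex function equals its upper semicontinuous envelope
  almost everywhere. Now take the envelope \<open>U\<close> of \<open>f\<close> in the first variable: it is an infimum
  over countably many intervals, each contributing a supremum of sections in \<open>y\<close> on a strip of
  points \<open>x\<close>, and is therefore jointly measurable. The envelope \<open>V\<close> in the second variable is jointly measurable too. On almost
  every point of each horizontal line \<open>U = f \<le> V\<close>, and on almost every point of each vertical line
  \<open>V = f \<le> U\<close>, so by Fubini \<open>U = V\<close> almost everywhere, and \<open>U\<close> agrees almost everywhere with \<open>f\<close>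
  along almost all lines in both directions (\<open>jointly_measurable_version\<close>).

  Integrability. On each section, \<open>f\<close> is bounded above by the maximum of its two end values and its
  value at almost any third point (\<open>J_quasi_convex_AE_dominated\<close>). As functions of the other
  variable these three values are integrable, so the positive part of the jointly measurable
  version is integrable on the rectangle; the negative part is then controlled by the hypothesis that the iterated integral of
  \<open>f\<close> exists (\<open>jointly_measurable_version_integrable\<close>). With an integrable version of \<open>f\<close> at hand,
  Fubini's theorem applies.
\<close>

section \<open>Measurable midpoint-convex sets of reals\<close>

text \<open>A weak form of Lebesgue's density theorem. By Vitali's covering theorem, an open set \<open>U\<close> of measure
  barely larger than that of \<open>A\<close> contains disjoint balls that cover \<open>A\<close> up to a null set. If \<open>A\<close>
  occupied at most the fraction \<open>\<theta>\<close> of each ball, its measure would be at most \<open>\<theta>\<close> times its own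
  measure, up to an arbitrarily small error.\<close>

lemma negligible_if_small_density:
  fixes A :: "'a::euclidean_space set"
  assumes A: "A \<in> lmeasurable" and \<theta>: "0 \<le> \<theta>" "\<theta> < 1"
    and small: "\<And>x r. 0 < r \<Longrightarrow> measure lebesgue (A \<inter> cball x r) \<le> \<theta> * measure lebesgue (cball x r)"
  shows "negligible A"
proof -
  let ?m = "measure lebesgue"
  have *: "?m A \<le> \<theta> * (?m A + e)" if e: "e > 0" for e
  proof -
    obtain U where U0: "open U" "A \<subseteq> U" "U - A \<in> lmeasurable" "emeasure lebesgue (U - A) < ennreal e"
      using sets_lebesgue_outer_open[OF fmeasurableD[OF A] e] by metis
    have "A \<union> (U - A) \<in> lmeasurable" using A U0 by (intro fmeasurable.Un)
    moreover have "?m (A \<union> (U - A)) = ?m A + ?m (U - A)"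
      using A U0 by (intro measure_Un_AE) auto
    moreover have "?m (U - A) < e"
      using U0 e by (simp add: emeasure_eq_measure2 ennreal_less_iff)
    moreover have "A \<union> (U - A) = U" using U0 by auto
    ultimately have U: "open U" "A \<subseteq> U" "U \<in> lmeasurable" "?m U < ?m A + e"
      using U0 by auto
    define K where "K = {(x, r). 0 < r \<and> cball x r \<subseteq> U}"
    have pos: "0 < snd i" if "i \<in> K" for i using that by (auto simp: K_def)
    have fine: "\<exists>i. i \<in> K \<and> x \<in> cball (fst i) (snd i) \<and> snd i < d" if "x \<in> A" "0 < d" for x d
    proof -
      obtain s where s: "s > 0" "cball x s \<subseteq> U"
        using U \<open>x \<in> A\<close> open_contains_cball by (metis subsetD)
      have "(x, min s (d/2)) \<in> K"
        using s \<open>0 < d\<close> by (auto simp: K_def)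
      then show ?thesis using s \<open>0 < d\<close> by (intro exI[of _ "(x, min s (d/2))"]) auto
    qed
    obtain C where C: "countable C" "C \<subseteq> K"
      "pairwise (\<lambda>i j. disjnt (cball (fst i) (snd i)) (cball (fst j) (snd j))) C"
      "negligible (A - (\<Union>i\<in>C. cball (fst i) (snd i)))"
      using Vitali_covering_theorem_cballs[of K snd A fst, OF pos fine] by blast
    let ?B = "\<lambda>i. cball (fst i) (snd i)"
    have disj: "disjoint_family_on ?B C"
      using C(3) by (auto simp: disjoint_family_on_def pairwise_def disjnt_def)
    then have disj_A: "disjoint_family_on (\<lambda>i. A \<inter> ?B i) C"
      unfolding disjoint_family_on_def by blast
    have A_sets: "A \<in> sets lebesgue" using A by auto
    have "(\<Union>i\<in>C. ?B i) \<in> sets lebesgue" using C by (intro sets.countable_UN') auto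
    then have union_sets: "(\<Union>i\<in>C. A \<inter> ?B i) \<in> sets lebesgue" "A - (\<Union>i\<in>C. ?B i) \<in> sets lebesgue"
      using A_sets unfolding Int_UN_distrib[symmetric] by (auto simp del: UN_simps)
    have "emeasure lebesgue A \<le> emeasure lebesgue ((\<Union>i\<in>C. A \<inter> ?B i) \<union> (A - (\<Union>i\<in>C. ?B i)))"
      using union_sets by (intro emeasure_mono sets.Un) auto
    also have "\<dots> = emeasure lebesgue (\<Union>i\<in>C. A \<inter> ?B i)"
      using C union_sets by (intro emeasure_Un_null_set) (auto simp: negligible_iff_null_sets)
    also have "\<dots> = (\<integral>\<^sup>+i. emeasure lebesgue (A \<inter> ?B i) \<partial>count_space C)"
      using disj_A C A_sets by (intro emeasure_UN_countable) auto
    also have "\<dots> \<le> (\<integral>\<^sup>+i. ennreal \<theta> * emeasure lebesgue (?B i) \<partial>count_space C)"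
    proof (intro nn_integral_mono)
      fix i assume "i \<in> space (count_space C)"
      then have "snd i > 0" using C by (auto simp: K_def)
      have L: "A \<inter> ?B i \<in> lmeasurable" "?B i \<in> lmeasurable"
        using A by (auto intro: fmeasurable.Int)
      show "emeasure lebesgue (A \<inter> ?B i) \<le> ennreal \<theta> * emeasure lebesgue (?B i)"
        using small[OF \<open>snd i > 0\<close>, of "fst i"] \<theta> 
        by (simp add: emeasure_eq_measure2[OF L(1)] emeasure_eq_measure2[OF L(2)]
            ennreal_mult[symmetric] ennreal_leI del: emeasure_completion)
    qed
    also have "\<dots> = ennreal \<theta> * emeasure lebesgue (\<Union>i\<in>C. ?B i)"
      using disj C by (subst emeasure_UN_countable) (auto simp: nn_integral_cmult)
    also have "\<dots> \<le> ennreal \<theta> * emeasure lebesgue U"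
    proof (intro mult_left_mono emeasure_mono)
      have "?B i \<subseteq> U" if "i \<in> K" for i using that by (auto simp: K_def)
      then show "(\<Union>i\<in>C. ?B i) \<subseteq> U" using C(2) by blast
    qed (use U in auto)
    finally have "ennreal (?m A) \<le> ennreal (\<theta> * ?m U)"
      using A U \<theta> by (simp add: emeasure_eq_measure2 ennreal_mult del: emeasure_completion)
    then have "?m A \<le> \<theta> * ?m U" using \<theta> by (simp add: ennreal_le_iff)
    also have "\<dots> \<le> \<theta> * (?m A + e)" using U \<theta> by (intro mult_left_mono) auto
    finally show ?thesis .
  qed
  have "?m A \<le> \<theta> * ?m A + e" if "e > 0" for e
  proof -
    have "\<theta> * e \<le> e" using that \<theta> by simp
    then show ?thesis using * [OF that] by (simp add: distrib_left)
  qed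
  then have "?m A \<le> \<theta> * ?m A" by (rule field_le_epsilon)
  then have "?m A = 0"
    using \<theta> measure_nonneg[of lebesgue A] mult_le_cancel_right1[of "?m A" \<theta>] by linarith
  then show ?thesis using A negligible_iff_measure by blast
qed

lemma measurable_reflection: "(\<lambda>x::real. s - x) \<in> lebesgue \<rightarrow>\<^sub>M lebesgue"
  using lebesgue_affine_measurable[of "\<lambda>_::real. -1" s] by simp

lemma emeasure_reflection:
  fixes A :: "real set"
  assumes "A \<in> sets lebesgue"
  shows "(\<lambda>x. s - x) -` A \<in> sets lebesgue"
    and "emeasure lebesgue ((\<lambda>x. s - x) -` A) = emeasure lebesgue A"
proof -
  show "(\<lambda>x. s - x) -` A \<in> sets lebesgue"
    using measurable_sets[OF measurable_reflection assms, of s] by simp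
  have "(\<lambda>x. s - x) -` A = (\<lambda>x. (-1) *\<^sub>R x + s) ` A"
    by (force simp: image_iff)
  then show "emeasure lebesgue ((\<lambda>x. s - x) -` A) = emeasure lebesgue A"
    using emeasure_lebesgue_affine[of "-1" s A] by simp
qed

lemma AE_reflection:
  fixes P :: "real \<Rightarrow> bool"
  assumes "AE x in lebesgue. P x"
  shows "AE x in lebesgue. P (s - x)"
proof -
  obtain N where N: "negligible N" "{x. \<not> P x} \<subseteq> N"
    using assms unfolding eventually_ae_filter_negligible by blast
  then have "negligible ((\<lambda>x. s - x) -` N)"
    using emeasure_reflection[of N s] by (simp add: negligible_iff_null_sets null_sets_def)
  moreover have "{x. \<not> P (s - x)} \<subseteq> (\<lambda>x. s - x) -` N" using N(2) by blast
  ultimately show ?thesis unfolding eventually_ae_filter_negligible by blast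
qed

definition midpoint_convex :: "real set \<Rightarrow> bool" where
  "midpoint_convex A \<longleftrightarrow> (\<forall>u\<in>A. \<forall>v\<in>A. (u + v) / 2 \<in> A)"

lemma midpoint_convexD: "midpoint_convex A \<Longrightarrow> u \<in> A \<Longrightarrow> v \<in> A \<Longrightarrow> (u + v) / 2 \<in> A"
  by (auto simp: midpoint_convex_def)

text \<open>The idea is that of Steinhaus' theorem. Near the centre of a ball in which \<open>A\<close> has density above
  \<open>3/4\<close>, reflecting \<open>A\<close> in a point \<open>z\<close> moves it so little that \<open>A\<close> and its mirror image must still
  meet, which exhibits \<open>z\<close> as the midpoint of two points of \<open>A\<close>.\<close>

lemma midpoint_convex_interior_nonempty:
  assumes A: "A \<in> lmeasurable" and mid: "midpoint_convex A" and nn: "\<not> negligible A"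
  shows "interior A \<noteq> {}"
proof -
  let ?m = "measure lebesgue"
  have "\<exists>x r. 0 < r \<and> ?m (A \<inter> cball x r) > 3/4 * ?m (cball x r)"
    using negligible_if_small_density[OF A, of "3/4"] nn by (force simp: not_le)
  then obtain x r where r: "r > 0" and "?m (A \<inter> cball x r) > 3/4 * ?m (cball x r)" by blast
  then have dens: "?m (A \<inter> cball x r) > 3/2 * r" by (simp add: cball_eq_atLeastAtMost)
  define P where "P = A \<inter> cball x r"
  have P: "P \<in> lmeasurable" using A by (auto simp: P_def intro: fmeasurable.Int)
  \<comment> \<open>Both \<open>P\<close> and its reflection \<open>Q\<close> in \<open>z\<close> lie in an interval of length \<open>5/2 * r\<close>, but each has
    measure more than \<open>3/2 * r\<close>.\<close>
  have "z \<in> A" if z: "z \<in> ball x (r/4)" for z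
  proof -
    define Q where "Q = (\<lambda>p. 2 * z - p) -` P"
    have Q: "Q \<in> lmeasurable" "?m Q = ?m P"
      using emeasure_reflection[of P "2 * z"] P
      by (simp_all add: Q_def fmeasurable_def measure_def del: emeasure_completion)
    have "P \<inter> Q \<noteq> {}"
    proof
      assume "P \<inter> Q = {}"
      then have "?m P + ?m Q = ?m (P \<union> Q)"
        using P Q fmeasurableD2[OF P] fmeasurableD2[OF Q(1)]
          by (intro measure_Union[symmetric]) (auto simp: fmeasurableD simp del: emeasure_completion)
      also have "\<dots> \<le> ?m (cball z (5/4 * r))"
      proof (intro measure_mono_fmeasurable)
        have "\<bar>z - x\<bar> < r/4" using z by (simp add: dist_real_def abs_minus_commute)
        have "\<bar>z - t\<bar> \<le> 5/4 * r" if "t \<in> P \<union> Q" for t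
        proof -
          from that have "\<bar>x - t\<bar> \<le> r \<or> \<bar>x - (2 * z - t)\<bar> \<le> r"
            by (auto simp: P_def Q_def dist_real_def)
          then show ?thesis using \<open>\<bar>z - x\<bar> < r/4\<close> by arith
        qed
        then show "P \<union> Q \<subseteq> cball z (5/4 * r)"
          by (auto simp: dist_real_def)
      qed (use P Q in \<open>auto simp: fmeasurableD\<close>)
      also have "\<dots> = 5/2 * r" using r by (simp add: cball_eq_atLeastAtMost)
      finally show False using Q dens r by (simp add: P_def)
    qed
    then obtain p where "p \<in> A" "2 * z - p \<in> A"
      by (auto simp: P_def Q_def)
    then show "z \<in> A" using midpoint_convexD[OF mid, of p "2*z-p"] by simp
  qed
  then have "ball x (r/4) \<subseteq> interior A"
    by (intro interior_maximal) auto
  then show ?thesis using r by (metis centre_in_ball divide_pos_pos empty_iff subsetD zero_less_numeral)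
qed

text \<open>If \<open>A\<close> had a gap around \<open>w\<close>, the midpoint of two points of \<open>A\<close> sufficiently close to the two ends of
  a maximal gap would fall inside it.\<close>

lemma midpoint_convex_dense:
  assumes mid: "midpoint_convex A" and "u \<in> A" "v \<in> A" and w: "u < w" "w < v" and e: "e > 0"
  shows "\<exists>q\<in>A. \<bar>q - w\<bar> < e"
proof (rule ccontr)
  assume far: "\<not> ?thesis"
  define s where "s = Sup (A \<inter> {..w})"
  define t where "t = Inf (A \<inter> {w..})"
  have L: "u \<in> A \<inter> {..w}" and R: "v \<in> A \<inter> {w..}" using assms by auto
  have far': "q \<le> w - e \<or> q \<ge> w + e" if "q \<in> A" for q using far that by fastforce
  have sle: "s \<le> w - e" unfolding s_def using L far' e by (intro cSup_least) force+
  have tge: "t \<ge> w + e" unfolding t_def using R far' e by (intro cInf_greatest) force+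
  obtain p where p: "p \<in> A" "p \<le> w" "s - e/2 < p"
    using less_cSupE[of "s - e/2" "A \<inter> {..w}"] L e by (auto simp: s_def)
  obtain q where q: "q \<in> A" "q \<ge> w" "q < t + e/2"
    using cInf_lessD[of "A \<inter> {w..}" "t + e/2"] R e by (auto simp: t_def)
  have m: "(p + q) / 2 \<in> A" using midpoint_convexD[OF mid] p q by blast
  have ps: "p \<le> s" unfolding s_def using p by (intro cSup_upper) auto
  have tq: "t \<le> q" unfolding t_def using q by (intro cInf_lower) auto
  show False
  proof (cases "(p + q) / 2 \<le> w")
    case True
    then have "(p + q) / 2 \<le> s" unfolding s_def using m by (intro cSup_upper) auto
    then show False using p tq sle tge e by (simp add: field_simps)
  next
    case False
    then have "t \<le> (p + q) / 2" unfolding t_def using m by (intro cInf_lower) auto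
    then show False using q ps sle tge e by (simp add: field_simps)
  qed
qed

text \<open>Iterated halving towards \<open>q\<close>; in contrast to density, this hits prescribed points exactly.\<close>

lemma midpoint_convex_dyadic:
  assumes mid: "midpoint_convex A" and "q \<in> A" "p \<in> A"
  shows "q + (p - q) / 2 ^ n \<in> A"
proof (induction n)
  case (Suc n)
  have "(q + (q + (p - q) / 2 ^ n)) / 2 = q + (p - q) / 2 ^ Suc n" by (simp add: field_simps)
  then show ?case using midpoint_convexD[OF mid \<open>q \<in> A\<close> Suc] by metis
qed (use assms in simp)

text \<open>Let \<open>z\<close> lie between two points of \<open>A\<close>. By density there is \<open>q\<close> in \<open>A\<close> near \<open>z\<close>, and \<open>z\<close> is the
  \<open>n\<close>-fold halving towards \<open>q\<close> of some point \<open>p'\<close>. The point \<open>q\<close> can be chosen so well that \<open>p'\<close>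
  falls into a ball contained in \<open>A\<close>.\<close>

lemma midpoint_convex_imp_convex:
  assumes mid: "midpoint_convex A" and int: "interior A \<noteq> {}"
  shows "convex A"
proof -
  obtain p r where r: "r > 0" and ball: "ball p r \<subseteq> A"
    using int by (auto simp: mem_interior)
  have "z \<in> A" if uv: "u \<in> A" "v \<in> A" and z: "u < z" "z < v" for u v z
  proof -
    \<comment> \<open>The point \<open>w n\<close> is the exact choice of \<open>q\<close> for which \<open>p'\<close> would be the centre \<open>p\<close>.\<close>
    define w where "w n = (z - p / 2 ^ n) / (1 - 1 / 2 ^ n)" for n :: nat
    have "w \<longlonglongrightarrow> (z - 0) / (1 - 0)"
      unfolding w_def by (intro tendsto_intros LIMSEQ_divide_realpow_zero) auto
    then have "\<forall>\<^sub>F n in sequentially. u < w n \<and> w n < v"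
      using z by (intro eventually_conj order_tendstoD[of w z]) auto
    then obtain N where "\<And>n. n \<ge> N \<Longrightarrow> u < w n \<and> w n < v"
      by (auto simp: eventually_sequentially)
    then obtain n where n: "n \<ge> 1" "u < w n" "w n < v"
      by (metis le_add1 le_add2)
    have big: "(2::real) ^ n > 1" using n by (simp add: one_less_power)
    have "r / (2 ^ n - 1) > 0" using r big by simp
    then obtain q where q: "q \<in> A" "\<bar>q - w n\<bar> < r / (2 ^ n - 1)"
      using midpoint_convex_dense[OF mid uv n(2,3)] by metis
    define p' where "p' = q + 2 ^ n * (z - q)"
    have "p' - p = (2 ^ n - 1) * (w n - q)"
      using big by (simp add: p'_def w_def divide_simps) algebra
    then have "\<bar>p' - p\<bar> < r"
      using q(2) big by (simp add: abs_mult pos_less_divide_eq abs_minus_commute mult.commute)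
    then have "p' \<in> A" using ball by (auto simp: dist_real_def abs_minus_commute)
    then have "q + (p' - q) / 2 ^ n \<in> A" by (rule midpoint_convex_dyadic[OF mid q(1)])
    then show ?thesis by (simp add: p'_def)
  qed
  then have "is_interval A" unfolding is_interval_1 by (metis order_le_less)
  then show ?thesis by (simp add: is_interval_convex_1)
qed

lemma midpoint_convex_negligible_or_convex:
  assumes "A \<in> lmeasurable" "midpoint_convex A"
  shows "negligible A \<or> convex A"
  using midpoint_convex_imp_convex[OF assms(2) midpoint_convex_interior_nonempty[OF assms]] by metis

section \<open>Measurable J-quasi-convex functions\<close>

lemma negligible_imp_AE_lebesgue_on:
  assumes "negligible N" "S \<in> sets lebesgue" "\<And>x. x \<in> S \<Longrightarrow> x \<notin> N \<Longrightarrow> P x"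
  shows "AE x in lebesgue_on S. P x"
proof -
  have "AE x in lebesgue. x \<in> S \<longrightarrow> P x"
    unfolding eventually_ae_filter_negligible using assms by blast
  then show ?thesis using assms by (simp add: AE_restrict_space_iff)
qed

lemma convex_bounded_sets_lebesgue:
  fixes A :: "'a::euclidean_space set"
  assumes "convex A" "bounded A"
  shows "A \<in> sets lebesgue"
  using assms by (intro fmeasurableD measurable_convex)

lemma bounded_Collect_Icc: "bounded {x\<in>{a..b::real}. P x}"
  by (rule bounded_subset[of "{a..b}"]) auto

lemma J_quasi_convex_sublevel:
  assumes J: "J_quasi_convex_on {a..b} g" and g: "g \<in> borel_measurable (lebesgue_on {a..b})"
  shows "negligible {x\<in>{a..b}. g x \<le> t} \<or> convex {x\<in>{a..b}. g x \<le> t}"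
proof (rule midpoint_convex_negligible_or_convex)
  have "{x \<in> space (lebesgue_on {a..b}). g x \<le> t} \<in> sets (lebesgue_on {a..b})"
    using g by measurable
  then have "{x\<in>{a..b}. g x \<le> t} \<in> sets lebesgue"
    by (simp add: sets_restrict_space_iff)
  then show "{x\<in>{a..b}. g x \<le> t} \<in> lmeasurable"
    using bounded_Collect_Icc by (rule bounded_set_imp_lmeasurable[rotated])
  show "midpoint_convex {x\<in>{a..b}. g x \<le> t}"
    unfolding midpoint_convex_def
  proof (intro ballI)
    fix u v assume uv: "u \<in> {x\<in>{a..b}. g x \<le> t}" "v \<in> {x\<in>{a..b}. g x \<le> t}"
    then have "g ((u + v) / 2) \<le> max (g u) (g v)"
      using J unfolding J_quasi_convex_on_def by blast
    then show "(u + v) / 2 \<in> {x\<in>{a..b}. g x \<le> t}" using uv by (auto simp: max_def split: if_splits)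
  qed
qed

text \<open>The index set \<open>U\<close> may be uncountable. A sublevel set of the supremum is an intersection of sublevel
  sets of the \<open>G u\<close>: if one of them is null, so is the intersection, and otherwise all of them are
  convex, hence so is the intersection.\<close>

lemma J_quasi_convex_SUP_measurable:
  assumes J: "\<And>u. u \<in> U \<Longrightarrow> J_quasi_convex_on {a..b} (G u)"
    and G: "\<And>u. u \<in> U \<Longrightarrow> G u \<in> borel_measurable (lebesgue_on {a..b})"
  shows "(\<lambda>y. SUP u\<in>U. ereal (G u y)) \<in> borel_measurable (lebesgue_on {a..b})"
proof (rule borel_measurableI_le)
  let ?L = "\<lambda>t u. {y\<in>{a..b}. G u y \<le> t}"
  have *: "{y\<in>{a..b}. \<forall>u\<in>U. G u y \<le> t} \<in> sets lebesgue" for t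
  proof (cases "\<exists>u\<in>U. negligible (?L t u)")
    case True
    then obtain u where "u \<in> U" "negligible (?L t u)" by blast
    then have "negligible {y\<in>{a..b}. \<forall>u\<in>U. G u y \<le> t}"
      by (elim negligible_subset) auto
    then show ?thesis by (rule negligible_imp_sets)
  next
    case False
    then have "convex (\<Inter>u\<in>U. ?L t u)"
      using J_quasi_convex_sublevel[OF J G] by (intro convex_INT) blast
    then have "convex ({a..b} \<inter> (\<Inter>u\<in>U. ?L t u))" by (intro convex_Int) auto
    moreover have "{a..b} \<inter> (\<Inter>u\<in>U. ?L t u) = {y\<in>{a..b}. \<forall>u\<in>U. G u y \<le> t}" by auto
    ultimately have "convex {y\<in>{a..b}. \<forall>u\<in>U. G u y \<le> t}" by (simp only:)
    then show ?thesis using bounded_Collect_Icc by (rule convex_bounded_sets_lebesgue)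
  qed
  show "{y \<in> space (lebesgue_on {a..b}). (SUP u\<in>U. ereal (G u y)) \<le> t} \<in> sets (lebesgue_on {a..b})" for t
  proof (cases t)
    case (real r)
    then have "{y \<in> space (lebesgue_on {a..b}). (SUP u\<in>U. ereal (G u y)) \<le> t} = {y\<in>{a..b}. \<forall>u\<in>U. G u y \<le> r}"
      by (simp add: SUP_le_iff)
    then show ?thesis using *[of r] by (subst sets_restrict_space_iff) auto
  next
    case PInf
    then have "{y \<in> space (lebesgue_on {a..b}). (SUP u\<in>U. ereal (G u y)) \<le> t} = space (lebesgue_on {a..b})"
      by auto
    then show ?thesis by (simp only: sets.top)
  next
    case MInf
    show ?thesis
    proof (cases "U = {}")
      case True
      have "{y \<in> space (lebesgue_on {a..b}). (SUP u\<in>U. ereal (G u y)) \<le> t} = space (lebesgue_on {a..b})"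
        unfolding True by auto
      then show ?thesis by (simp only: sets.top)
    next
      case False
      then have "\<not> (SUP u\<in>U. ereal (G u y)) \<le> t" for y
        unfolding MInf SUP_le_iff by simp
      then have "{y \<in> space (lebesgue_on {a..b}). (SUP u\<in>U. ereal (G u y)) \<le> t} = {}" by blast
      then show ?thesis by (simp only: sets.empty_sets)
    qed
  qed
qed

text \<open>Rational end points keep the infimum in the envelope below countable, hence measurable.\<close>

definition rational_intervals :: "real \<Rightarrow> real \<Rightarrow> (real \<times> real) set" where
  "rational_intervals a b = {(p, q) \<in> \<rat> \<times> \<rat>. a \<le> p \<and> q \<le> b}"

lemma countable_rational_intervals: "countable (rational_intervals a b)"
  unfolding rational_intervals_def
  by (rule countable_subset[of _ "\<rat> \<times> \<rat>"]) (auto simp: countable_rat)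

text \<open>The smallest upper semicontinuous majorant of \<open>g\<close> at the points strictly between \<open>a\<close> and \<open>b\<close>. The
  value \<open>\<infinity>\<close> is neutral for the infimum, so intervals that miss \<open>x\<close> are ignored; at points that lie
  in no rational interval, such as \<open>a\<close> and \<open>b\<close>, the envelope is \<open>\<infinity>\<close>.\<close>

definition upper_envelope :: "real \<Rightarrow> real \<Rightarrow> (real \<Rightarrow> real) \<Rightarrow> real \<Rightarrow> ereal" where
  "upper_envelope a b g x =
     (INF i\<in>rational_intervals a b.
        if x \<in> {fst i<..<snd i} then SUP u\<in>{fst i<..<snd i}. ereal (g u) else \<infinity>)"

lemma upper_envelope_ge: "ereal (g x) \<le> upper_envelope a b g x"
  unfolding upper_envelope_def by (intro INF_greatest) (auto intro: SUP_upper)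

lemma upper_envelope_le:
  assumes x: "x \<in> interior {x\<in>{a..b}. g x \<le> t}"
  shows "upper_envelope a b g x \<le> ereal t"
proof -
  obtain e where e: "e > 0" "ball x e \<subseteq> {x\<in>{a..b}. g x \<le> t}"
    using x by (auto simp: mem_interior)
  obtain p where p: "p \<in> \<rat>" "x - e < p" "p < x" using Rats_dense_in_real[of "x - e" x] e by auto
  obtain q where q: "q \<in> \<rat>" "x < q" "q < x + e" using Rats_dense_in_real[of x "x + e"] e by auto
  have "{p..q} \<subseteq> ball x e" using p q by (auto simp: dist_real_def)
  then have sub: "{p..q} \<subseteq> {x\<in>{a..b}. g x \<le> t}" using e by blast
  have "p \<in> {p..q}" "q \<in> {p..q}" using p q by auto
  then have "p \<in> {a..b}" "q \<in> {a..b}" using sub by blast+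
  then have pq: "(p, q) \<in> rational_intervals a b"
    using p q by (simp add: rational_intervals_def)
  have "upper_envelope a b g x \<le> (SUP u\<in>{p<..<q}. ereal (g u))"
    unfolding upper_envelope_def using p q by (intro INF_lower2[OF pq]) auto
  also have "\<dots> \<le> ereal t" using subsetD[OF sub] by (intro SUP_least) auto
  finally show ?thesis .
qed

text \<open>The envelope exceeds \<open>g\<close> at \<open>x\<close> only if, for some rational \<open>t\<close>, the point \<open>x\<close> belongs to the sublevel
  set of \<open>t\<close> but not to its interior. Sublevel sets that are null contribute null sets, and convex ones
  contribute only boundary points.\<close>

lemma upper_envelope_AE_eq:
  assumes J: "J_quasi_convex_on {a..b} g" and g: "g \<in> borel_measurable (lebesgue_on {a..b})"
  shows "AE x in lebesgue_on {a..b}. upper_envelope a b g x = ereal (g x)"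
proof -
  let ?L = "\<lambda>t. {x\<in>{a..b}. g x \<le> t}"
  define N where "N = (\<Union>t\<in>\<rat>. ?L t - interior (?L t))"
  have "negligible (?L t - interior (?L t))" for t
    using J_quasi_convex_sublevel[OF J g, of t]
  proof
    assume "convex (?L t)"
    from negligible_convex_frontier[OF this] show ?thesis
      by (rule negligible_subset) (auto simp: frontier_def intro: subsetD[OF closure_subset])
  qed (auto intro: negligible_subset)
  then have "negligible N" unfolding N_def
    by (intro negligible_countable_Union) (auto simp: countable_rat)
  then show ?thesis
  proof (rule negligible_imp_AE_lebesgue_on)
    fix x assume x: "x \<in> {a..b}" "x \<notin> N"
    have "upper_envelope a b g x \<le> ereal (g x)"
    proof (rule dense_ge)
      fix s assume "ereal (g x) < s"
      then obtain r where r: "ereal (g x) < ereal r" "ereal r < s"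
        using ereal_dense2 by blast
      then obtain t where t: "t \<in> \<rat>" "g x < t" "t < r" using Rats_dense_in_real[of "g x" r] by auto
      then have "x \<in> interior (?L t)" using x by (auto simp: N_def)
      then have "upper_envelope a b g x \<le> ereal t" by (rule upper_envelope_le)
      also have "\<dots> < ereal r" using t by simp
      also note r(2)
      finally show "upper_envelope a b g x \<le> s" by (rule less_imp_le)
    qed
    then show "upper_envelope a b g x = ereal (g x)"
      using upper_envelope_ge by (rule antisym)
  qed simp
qed

text \<open>For each of the countably many rational intervals, the term in the infimum depends on \<open>x\<close> only
  through membership in the interval and on \<open>y\<close> only through a supremum of sections, which is
  measurable by \<open>J_quasi_convex_SUP_measurable\<close>.\<close>

lemma upper_envelope_measurable:
  assumes J: "\<And>x. x \<in> {a..b} \<Longrightarrow> J_quasi_convex_on {c..d} (\<lambda>y. f (x, y))"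
    and f: "\<And>x. x \<in> {a..b} \<Longrightarrow> (\<lambda>y. f (x, y)) \<in> borel_measurable (lebesgue_on {c..d})"
  shows "(\<lambda>(x, y). upper_envelope a b (\<lambda>u. f (u, y)) x)
           \<in> borel_measurable (lebesgue_on {a..b} \<Otimes>\<^sub>M lebesgue_on {c..d})"
proof -
  have "(\<lambda>z. if fst z \<in> {fst i<..<snd i} then SUP u\<in>{fst i<..<snd i}. ereal (f (u, snd z)) else \<infinity>)
      \<in> borel_measurable (lebesgue_on {a..b} \<Otimes>\<^sub>M lebesgue_on {c..d})" (is "?h i \<in> _")
    if i: "i \<in> rational_intervals a b" for i
  proof (rule measurable_If)
    have sub: "u \<in> {a..b}" if "u \<in> {fst i<..<snd i}" for u
      using that i by (auto simp: rational_intervals_def)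
    have "(\<lambda>y. SUP u\<in>{fst i<..<snd i}. ereal (f (u, y))) \<in> borel_measurable (lebesgue_on {c..d})"
      using sub by (intro J_quasi_convex_SUP_measurable J f)
    from measurable_compose[OF measurable_snd this]
    show "(\<lambda>z. SUP u\<in>{fst i<..<snd i}. ereal (f (u, snd z)))
        \<in> borel_measurable (lebesgue_on {a..b} \<Otimes>\<^sub>M lebesgue_on {c..d})" .
    have "{fst i<..<snd i} \<inter> {a..b} \<in> sets (lebesgue_on {a..b})"
      by (subst sets_restrict_space_iff) auto
    then have "({fst i<..<snd i} \<inter> {a..b}) \<times> {c..d} \<in> sets (lebesgue_on {a..b} \<Otimes>\<^sub>M lebesgue_on {c..d})"
      by (intro pair_measureI) (auto simp: sets_restrict_space_iff)
    moreover have "({fst i<..<snd i} \<inter> {a..b}) \<times> {c..d}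
        = {z \<in> space (lebesgue_on {a..b} \<Otimes>\<^sub>M lebesgue_on {c..d}). fst z \<in> {fst i<..<snd i}}"
      by (auto simp: space_pair_measure)
    ultimately show "{z \<in> space (lebesgue_on {a..b} \<Otimes>\<^sub>M lebesgue_on {c..d}). fst z \<in> {fst i<..<snd i}}
        \<in> sets (lebesgue_on {a..b} \<Otimes>\<^sub>M lebesgue_on {c..d})" by simp
  qed auto
  then have "(\<lambda>z. INF i\<in>rational_intervals a b. ?h i z)
      \<in> borel_measurable (lebesgue_on {a..b} \<Otimes>\<^sub>M lebesgue_on {c..d})"
    by (intro borel_measurable_INF countable_rational_intervals)
  then show ?thesis by (simp add: upper_envelope_def case_prod_beta')
qed

text \<open>The points that belong to a null sublevel set with rational level form a null set. For \<open>s\<close>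
  outside it, every sublevel set with rational level above the maximum on the right is not null,
  hence convex, and as it contains \<open>a\<close> and \<open>b\<close>, it is the whole interval.\<close>

lemma J_quasi_convex_AE_dominated:
  assumes J: "J_quasi_convex_on {a..b} g" and g: "g \<in> borel_measurable (lebesgue_on {a..b})"
  shows "AE s in lebesgue_on {a..b}. \<forall>x\<in>{a..b}. g x \<le> max (max (g a) (g b)) (g s)"
proof -
  let ?L = "\<lambda>t. {x\<in>{a..b}. g x \<le> t}"
  define N where "N = (\<Union>t\<in>{t\<in>\<rat>. negligible (?L t)}. ?L t)"
  have "countable {t\<in>\<rat>. negligible (?L t)}"
    by (rule countable_subset[OF _ countable_rat]) auto
  then have "negligible N" unfolding N_def
    by (intro negligible_countable_Union) auto
  then show ?thesis
  proof (rule negligible_imp_AE_lebesgue_on)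
    fix s assume s: "s \<in> {a..b}" "s \<notin> N"
    show "\<forall>x\<in>{a..b}. g x \<le> max (max (g a) (g b)) (g s)"
    proof (intro ballI leI notI)
      fix x assume x: "x \<in> {a..b}" "max (max (g a) (g b)) (g s) < g x"
      then obtain t where t: "t \<in> \<rat>" "max (max (g a) (g b)) (g s) < t" "t < g x"
        using Rats_dense_in_real by blast
      then have "s \<in> ?L t" using s by auto
      then have "\<not> negligible (?L t)" using s t by (auto simp: N_def)
      then have "convex (?L t)" using J_quasi_convex_sublevel[OF J g] by blast
      then have "is_interval (?L t)" by (simp add: is_interval_convex_1)
      moreover have "a \<in> ?L t" "b \<in> ?L t" using t x by auto
      ultimately have "x \<in> ?L t" using x unfolding is_interval_1 by (meson atLeastAtMost_iff)
      then show False using t by simp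
    qed
  qed simp
qed

section \<open>Joint measurability and integrability\<close>

lemma pair_sigma_finite_lebesgue_on:
  "pair_sigma_finite (lebesgue_on {a..b::real}) (lebesgue_on {c..d::real})"
proof -
  have "sigma_finite_measure (lebesgue_on {p..q})" for p q :: real
    by (intro finite_measure.axioms(1) finite_measure_lebesgue_on) simp
  then show ?thesis by (simp add: pair_sigma_finite_def)
qed

lemma AE_lebesgue_on_nonempty:
  assumes "a < b" "AE x in lebesgue_on {a..b::real}. P x"
  shows "\<exists>x\<in>{a..b}. P x"
proof (rule ccontr)
  assume no: "\<not> ?thesis"
  then have "AE x in lebesgue_on {a..b}. x \<notin> {a..b}"
    using assms(2) by (auto elim: eventually_mono)
  moreover have "{a..b} \<in> sets (lebesgue_on {a..b})"
    using sets.top[of "lebesgue_on {a..b}"] unfolding space_restrict_space by simp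
  ultimately have "{a..b} \<in> null_sets (lebesgue_on {a..b})"
    using AE_iff_null_sets by blast
  then show False using \<open>a < b\<close> by (simp add: null_sets_def emeasure_restrict_space)
qed

text \<open>The envelopes \<open>U\<close> and \<open>V\<close> of \<open>f\<close> in the first and in the second variable are jointly measurable
  majorants of \<open>f\<close>. Each is only known to agree with \<open>f\<close> along lines of one direction; Fubini's theorem
  shows that they agree with each other.\<close>

lemma jointly_measurable_version:
  fixes f :: "real \<times> real \<Rightarrow> real"
  assumes Jx: "\<And>x. x \<in> {a..b} \<Longrightarrow> J_quasi_convex_on {c..d} (\<lambda>y. f (x, y))"
    and Jy: "\<And>y. y \<in> {c..d} \<Longrightarrow> J_quasi_convex_on {a..b} (\<lambda>x. f (x, y))"
    and mx: "\<And>x. x \<in> {a..b} \<Longrightarrow> (\<lambda>y. f (x, y)) \<in> borel_measurable (lebesgue_on {c..d})"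
    and my: "\<And>y. y \<in> {c..d} \<Longrightarrow> (\<lambda>x. f (x, y)) \<in> borel_measurable (lebesgue_on {a..b})"
  obtains F :: "real \<times> real \<Rightarrow> real"
  where "F \<in> borel_measurable (lebesgue_on {a..b} \<Otimes>\<^sub>M lebesgue_on {c..d})"
    and "AE x in lebesgue_on {a..b}. AE y in lebesgue_on {c..d}. F (x, y) = f (x, y)"
    and "AE y in lebesgue_on {c..d}. AE x in lebesgue_on {a..b}. F (x, y) = f (x, y)"
proof -
  let ?A = "lebesgue_on {a..b}" and ?B = "lebesgue_on {c..d}"
  interpret pair_sigma_finite ?A ?B by (rule pair_sigma_finite_lebesgue_on)
  define U where "U x y = upper_envelope a b (\<lambda>u. f (u, y)) x" for x y
  define V where "V x y = upper_envelope c d (\<lambda>v. f (x, v)) y" for x y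
  have mU: "(\<lambda>z. U (fst z) (snd z)) \<in> borel_measurable (?A \<Otimes>\<^sub>M ?B)"
    using upper_envelope_measurable[of a b c d f, OF Jx mx] by (simp add: U_def case_prod_beta')
  have "(\<lambda>z. V (snd z) (fst z)) \<in> borel_measurable (?B \<Otimes>\<^sub>M ?A)"
    using upper_envelope_measurable[of c d a b "\<lambda>(y, x). f (x, y)"] Jy my
    by (simp add: V_def case_prod_beta')
  from measurable_compose[OF measurable_pair_swap' this]
  have mV: "(\<lambda>z. V (fst z) (snd z)) \<in> borel_measurable (?A \<Otimes>\<^sub>M ?B)"
    by (simp add: case_prod_beta')
  have le_U: "ereal (f (x, y)) \<le> U x y" for x y
    using upper_envelope_ge[of "\<lambda>u. f (u, y)"] by (simp add: U_def)
  have le_V: "ereal (f (x, y)) \<le> V x y" for x y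
    using upper_envelope_ge[of "\<lambda>v. f (x, v)"] by (simp add: V_def)
  have U_eq: "AE x in ?A. U x y = ereal (f (x, y))" if "y \<in> {c..d}" for y
    using upper_envelope_AE_eq[OF Jy my, OF that that] by (simp add: U_def)
  have V_eq: "AE y in ?B. V x y = ereal (f (x, y))" if "x \<in> {a..b}" for x
    using upper_envelope_AE_eq[OF Jx mx, OF that that] by (simp add: V_def)
  have "AE y in ?B. AE x in ?A. U x y \<le> V x y"
  proof (rule AE_I2)
    fix y assume "y \<in> space ?B"
    then have "y \<in> {c..d}" by simp
    from U_eq[OF this] show "AE x in ?A. U x y \<le> V x y"
      by eventually_elim (metis le_V)
  qed
  moreover have "{z \<in> space (?A \<Otimes>\<^sub>M ?B). U (fst z) (snd z) \<le> V (fst z) (snd z)} \<in> sets (?A \<Otimes>\<^sub>M ?B)"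
    using mU mV by (rule borel_measurable_le)
  ultimately have UV: "AE x in ?A. AE y in ?B. U x y \<le> V x y"
    by (subst AE_commute)
  have "AE x in ?A. AE y in ?B. real_of_ereal (U x y) = f (x, y)"
    using UV AE_space
  proof eventually_elim
    case (elim x)
    then have "AE y in ?B. V x y = ereal (f (x, y))" using V_eq by simp
    \<comment> \<open>Here \<open>f \<le> U \<le> V = f\<close> at almost every \<open>y\<close>.\<close>
    with elim(1) show ?case
    proof eventually_elim
      case (elim y)
      then have "U x y = ereal (f (x, y))" using le_U[of x y] by simp
      then show ?case by simp
    qed
  qed
  moreover have "AE y in ?B. AE x in ?A. real_of_ereal (U x y) = f (x, y)"
  proof (rule AE_I2)
    fix y assume "y \<in> space ?B"
    then have "y \<in> {c..d}" by simp
    from U_eq[OF this] show "AE x in ?A. real_of_ereal (U x y) = f (x, y)"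
      by eventually_elim simp
  qed
  moreover have "(\<lambda>z. real_of_ereal (U (fst z) (snd z))) \<in> borel_measurable (?A \<Otimes>\<^sub>M ?B)"
    using mU by (rule borel_measurable_real_of_ereal)
  ultimately show ?thesis
    using that[of "\<lambda>z. real_of_ereal (U (fst z) (snd z))"] by simp
qed

text \<open>An upper bound \<open>m\<close> and the value of the integral control the integral of the absolute value, because
  \<open>\<bar>g\<bar> \<le> 2 * m - g\<close>.\<close>

lemma integral_norm_le_dominated:
  fixes g :: "real \<Rightarrow> real"
  assumes "c \<le> d" and g: "integrable (lebesgue_on {c..d}) g"
    and dom: "\<And>y. y \<in> {c..d} \<Longrightarrow> g y \<le> m" and "0 \<le> m"
  shows "(\<integral>y. \<bar>g y\<bar> \<partial>lebesgue_on {c..d}) \<le> 2 * (d - c) * m + \<bar>\<integral>y. g y \<partial>lebesgue_on {c..d}\<bar>"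
proof -
  interpret finite_measure "lebesgue_on {c..d}" by (rule finite_measure_lebesgue_on) simp
  have "(\<integral>y. \<bar>g y\<bar> \<partial>lebesgue_on {c..d}) \<le> (\<integral>y. 2 * m - g y \<partial>lebesgue_on {c..d})"
  proof (rule integral_mono)
    fix y assume "y \<in> space (lebesgue_on {c..d})"
    then have "g y \<le> m" using dom by simp
    then show "\<bar>g y\<bar> \<le> 2 * m - g y" using \<open>0 \<le> m\<close> by arith
  qed (use g in auto)
  also have "\<dots> = 2 * (d - c) * m - (\<integral>y. g y \<partial>lebesgue_on {c..d})"
    using g \<open>c \<le> d\<close> by (simp add: measure_restrict_space)
  finally show ?thesis by linarith
qed

text \<open>The section at \<open>x\<close> is dominated by its values at \<open>c\<close>, \<open>d\<close> and almost any \<open>s\<close>. The function \<open>D (F (x, s)) x\<close>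
  is the resulting bound for the integral \<open>N x\<close> of the absolute value. The exceptional points \<open>s\<close> depend
  on \<open>x\<close>, and since both sides are jointly measurable, exchanging the quantifiers gives a single \<open>s\<close>
  that works for almost all \<open>x\<close> and makes the bound integrable in \<open>x\<close>.\<close>

lemma jointly_measurable_version_integrable:
  fixes f F :: "real \<times> real \<Rightarrow> real"
  assumes "c < d"
    and F: "F \<in> borel_measurable (lebesgue_on {a..b} \<Otimes>\<^sub>M lebesgue_on {c..d})"
    and Fx: "AE x in lebesgue_on {a..b}. AE y in lebesgue_on {c..d}. F (x, y) = f (x, y)"
    and Fy: "AE y in lebesgue_on {c..d}. AE x in lebesgue_on {a..b}. F (x, y) = f (x, y)"
    and J: "\<And>x. x \<in> {a..b} \<Longrightarrow> J_quasi_convex_on {c..d} (\<lambda>y. f (x, y))"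
    and ix: "\<And>x. x \<in> {a..b} \<Longrightarrow> integrable (lebesgue_on {c..d}) (\<lambda>y. f (x, y))"
    and iy: "\<And>y. y \<in> {c..d} \<Longrightarrow> integrable (lebesgue_on {a..b}) (\<lambda>x. f (x, y))"
    and ii: "integrable (lebesgue_on {a..b}) (\<lambda>x. \<integral>y. f (x, y) \<partial>lebesgue_on {c..d})"
  shows "integrable (lebesgue_on {a..b} \<Otimes>\<^sub>M lebesgue_on {c..d}) F"
proof -
  let ?A = "lebesgue_on {a..b}" and ?B = "lebesgue_on {c..d}"
  interpret pair_sigma_finite ?A ?B by (rule pair_sigma_finite_lebesgue_on)
  note [measurable] = F
  define N where "N x = (\<integral>y. \<bar>F (x, y)\<bar> \<partial>?B)" for x
  define D where "D s x = 2 * (d - c) * (\<bar>f (x, c)\<bar> + \<bar>f (x, d)\<bar> + \<bar>s\<bar>) + \<bar>\<integral>y. f (x, y) \<partial>?B\<bar>" for s x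
  have N[measurable]: "N \<in> borel_measurable ?A"
    unfolding N_def by measurable
  have [measurable]: "(\<lambda>x. f (x, c)) \<in> borel_measurable ?A" "(\<lambda>x. f (x, d)) \<in> borel_measurable ?A"
    using iy \<open>c < d\<close> by auto
  have [measurable]: "(\<lambda>x. \<integral>y. f (x, y) \<partial>?B) \<in> borel_measurable ?A" using ii by auto
  have sect: "integrable ?B (\<lambda>y. F (x, y)) \<and> N x = (\<integral>y. \<bar>f (x, y)\<bar> \<partial>?B)"
    if x: "x \<in> {a..b}" and eq: "AE y in ?B. F (x, y) = f (x, y)" for x
  proof
    have m: "(\<lambda>y. F (x, y)) \<in> borel_measurable ?B"
      using x by (intro measurable_compose[OF measurable_Pair1' F]) simp
    show "integrable ?B (\<lambda>y. F (x, y))"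
      using ix[OF x] by (rule integrable_cong_AE_imp[OF _ m]) (use eq in eventually_elim, simp)
    show "N x = (\<integral>y. \<bar>f (x, y)\<bar> \<partial>?B)"
      unfolding N_def using m ix[OF x] eq by (intro integral_cong_AE) auto
  qed
  \<comment> \<open>The bound is stated with \<open>F\<close>, not \<open>f\<close>, so that the quantifiers can be exchanged.\<close>
  have "AE x in ?A. AE s in ?B. N x \<le> D (F (x, s)) x"
    using Fx AE_space
  proof eventually_elim
    case (elim x)
    then have x: "x \<in> {a..b}" by simp
    have "AE s in ?B. \<forall>y\<in>{c..d}. f (x, y) \<le> max (max (f (x, c)) (f (x, d))) (f (x, s))"
      using J_quasi_convex_AE_dominated[OF J[OF x]] ix[OF x] by auto
    with elim(1) show ?case
    proof eventually_elim
      case (elim s)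
      then have "f (x, y) \<le> \<bar>f (x, c)\<bar> + \<bar>f (x, d)\<bar> + \<bar>f (x, s)\<bar>" if "y \<in> {c..d}" for y
        using that by fastforce
      then show ?case
        using sect[OF x] \<open>AE y in ?B. F (x, y) = f (x, y)\<close> elim(1) \<open>c < d\<close>
          integral_norm_le_dominated[OF _ ix[OF x], of "\<bar>f (x, c)\<bar> + \<bar>f (x, d)\<bar> + \<bar>f (x, s)\<bar>"]
        by (simp add: D_def)
    qed
  qed
  moreover have "{z \<in> space (?A \<Otimes>\<^sub>M ?B). N (fst z) \<le> D (F (fst z, snd z)) (fst z)} \<in> sets (?A \<Otimes>\<^sub>M ?B)"
    unfolding D_def by measurable
  ultimately have "AE s in ?B. AE x in ?A. N x \<le> D (F (x, s)) x"
    using AE_commute[of "\<lambda>x s. N x \<le> D (F (x, s)) x"] by (rule_tac iffD1)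
  with Fy have "AE s in ?B. AE x in ?A. N x \<le> D (f (x, s)) x"
  proof eventually_elim
    case (elim s)
    then show ?case by eventually_elim simp
  qed
  then obtain s where s: "s \<in> {c..d}" "AE x in ?A. N x \<le> D (f (x, s)) x"
    using AE_lebesgue_on_nonempty[OF \<open>c < d\<close>] by blast
  have "integrable ?A N"
  proof (rule Bochner_Integration.integrable_bound)
    show "integrable ?A (\<lambda>x. D (f (x, s)) x)"
      unfolding D_def using iy[OF s(1)] iy[of c] iy[of d] ii \<open>c < d\<close> by auto
    have nonneg: "0 \<le> N x" for x by (simp add: N_def)
    show "AE x in ?A. norm (N x) \<le> norm (D (f (x, s)) x)"
      using s(2) by eventually_elim (use nonneg in \<open>auto intro: order_trans[OF _ abs_ge_self]\<close>)
  qed (rule N)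
  then have "integrable ?A (\<lambda>x. \<integral>y. norm (F (x, y)) \<partial>?B)"
    unfolding N_def real_norm_def .
  moreover have "AE x in ?A. integrable ?B (\<lambda>y. F (x, y))"
    using Fx AE_space by eventually_elim (use sect in simp)
  ultimately show ?thesis by (rule Fubini_integrable[OF F])
qed

section \<open>The midpoint inequality\<close>

lemma set_lebesgue_integral_Icc:
  fixes g :: "real \<Rightarrow> real"
  shows "(LINT x:{a..b}|lebesgue. g x) = (\<integral>x. g x \<partial>lebesgue_on {a..b})"
  by (simp add: set_lebesgue_integral_def integral_restrict_space)

lemma integrable_lebesgue_on_Icc:
  fixes g :: "real \<Rightarrow> real"
  shows "integrable (lebesgue_on {a..b}) g \<longleftrightarrow> g absolutely_integrable_on {a..b}"
  by (simp add: set_integrable_def integrable_restrict_space)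

text \<open>Completeness of Lebesgue measure makes \<open>g\<close> measurable; this is how inner integrals of \<open>f\<close> inherit
  measurability in the outer variable from those of a jointly measurable version.\<close>

lemma lebesgue_on_integral_cong_AE:
  fixes g h :: "real \<Rightarrow> real"
  assumes h: "integrable (lebesgue_on {a..b}) h" and eq: "AE x in lebesgue_on {a..b}. g x = h x"
  shows "integrable (lebesgue_on {a..b}) g"
    and "(\<integral>x. g x \<partial>lebesgue_on {a..b}) = (\<integral>x. h x \<partial>lebesgue_on {a..b})"
proof -
  have "AE x in lebesgue. x \<in> {a..b} \<longrightarrow> g x = h x"
    using eq by (simp add: AE_restrict_space_iff)
  then obtain N where N: "negligible N" "{x. \<not> (x \<in> {a..b} \<longrightarrow> g x = h x)} \<subseteq> N"
    unfolding eventually_ae_filter_negligible by blast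
  have "h absolutely_integrable_on {a..b}"
    using h by (simp only: integrable_lebesgue_on_Icc)
  then have "g absolutely_integrable_on {a..b}"
    by (rule absolutely_integrable_spike[OF _ N(1)]) (use N(2) in blast)
  then show g: "integrable (lebesgue_on {a..b}) g"
    by (simp only: integrable_lebesgue_on_Icc)
  show "(\<integral>x. g x \<partial>lebesgue_on {a..b}) = (\<integral>x. h x \<partial>lebesgue_on {a..b})"
    using g h eq by (intro integral_cong_AE) auto
qed

lemma reflection_measurable_Icc:
  "(\<lambda>x::real. a + b - x) \<in> lebesgue_on {a..b} \<rightarrow>\<^sub>M lebesgue_on {a..b}"
  by (rule measurable_restrict_space3[OF measurable_reflection]) auto

lemma reflection_integral_Icc:
  fixes g :: "real \<Rightarrow> real"
  shows "(\<integral>x. g (a + b - x) \<partial>lebesgue_on {a..b}) = (\<integral>x. g x \<partial>lebesgue_on {a..b})"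
    and "integrable (lebesgue_on {a..b}) g \<Longrightarrow> integrable (lebesgue_on {a..b}) (\<lambda>x. g (a + b - x))"
proof -
  have ind: "indicator {a..b} (a + b - x) = (indicator {a..b} x :: real)" for x
    by (auto simp: indicator_def)
  show "(\<integral>x. g (a + b - x) \<partial>lebesgue_on {a..b}) = (\<integral>x. g x \<partial>lebesgue_on {a..b})"
    using lebesgue_integral_real_affine[of "-1" "\<lambda>x. indicator {a..b} x *\<^sub>R g x" "a + b"]
    by (simp add: integral_restrict_space ind)
  show "integrable (lebesgue_on {a..b}) (\<lambda>x. g (a + b - x))" if "integrable (lebesgue_on {a..b}) g"
    using lebesgue_integrable_real_affine[of "\<lambda>x. indicator {a..b} x *\<^sub>R g x" "-1" "a + b"] that
    by (simp add: integrable_restrict_space ind)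
qed

text \<open>The substitution \<open>x = a + (b - a) * t\<close>. Both sides are \<open>0\<close> when the integrand is not integrable.\<close>

lemma symmetric_difference_integral_rescale:
  fixes g :: "real \<Rightarrow> real"
  assumes "a < b"
  shows "(LINT t:{0..1}|lebesgue. \<bar>g (t * a + (1 - t) * b) - g ((1 - t) * a + t * b)\<bar>)
       = 1 / (b - a) * (\<integral>x. \<bar>g (a + b - x) - g x\<bar> \<partial>lebesgue_on {a..b})"
proof -
  let ?h = "\<lambda>x. indicator {a..b} x *\<^sub>R \<bar>g (a + b - x) - g x\<bar>"
  have ind: "indicator {a..b} (a + (b - a) * t) = (indicator {0..1} t :: real)" for t
  proof -
    have "a + (b - a) * t \<le> b \<longleftrightarrow> (b - a) * t \<le> (b - a) * 1" by (simp add: algebra_simps)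
    also have "\<dots> \<longleftrightarrow> t \<le> 1" using assms by (subst mult_le_cancel_left_pos) auto
    finally have 1: "a + (b - a) * t \<le> b \<longleftrightarrow> t \<le> 1" .
    have "a \<le> a + (b - a) * t \<longleftrightarrow> 0 \<le> t" using assms by (simp add: zero_le_mult_iff)
    with 1 show ?thesis unfolding indicator_def atLeastAtMost_iff by simp
  qed
  have "g (t * a + (1 - t) * b) = g (a + b - (a + (b - a) * t))"
    "g ((1 - t) * a + t * b) = g (a + (b - a) * t)" for t
    by (rule arg_cong[of _ _ g], simp add: algebra_simps)+
  then have "(LINT t:{0..1}|lebesgue. \<bar>g (t * a + (1 - t) * b) - g ((1 - t) * a + t * b)\<bar>)
      = (\<integral>t. ?h (a + (b - a) * t) \<partial>lebesgue)"
    unfolding set_lebesgue_integral_def by (simp only: ind)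
  moreover have "(\<integral>x. ?h x \<partial>lebesgue) = (b - a) * (\<integral>t. ?h (a + (b - a) * t) \<partial>lebesgue)"
    using lebesgue_integral_real_affine[of "b - a" ?h a] assms by simp
  ultimately show ?thesis using assms by (simp add: integral_restrict_space)
qed

text \<open>Average \<open>g ((a + b) / 2) \<le> max (g x) (g (a + b - x))\<close> over \<open>x\<close>, with the maximum of two numbers written
  as half of their sum plus their distance.\<close>

lemma J_quasi_convex_midpoint_le:
  assumes "a < b" and J: "J_quasi_convex_on {a..b} g" and g: "integrable (lebesgue_on {a..b}) g"
  shows "g ((a + b) / 2) \<le> 1 / (b - a) * (\<integral>x. g x \<partial>lebesgue_on {a..b})
      + 1 / 2 * (LINT t:{0..1}|lebesgue. \<bar>g (t * a + (1 - t) * b) - g ((1 - t) * a + t * b)\<bar>)"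
proof -
  let ?M = "lebesgue_on {a..b}"
  interpret finite_measure ?M by (rule finite_measure_lebesgue_on) simp
  note r = reflection_integral_Icc(2)[OF g]
  have "(b - a) * g ((a + b) / 2) = (\<integral>x. g ((a + b) / 2) \<partial>?M)"
    using \<open>a < b\<close> by (simp add: measure_restrict_space)
  also have "\<dots> \<le> (\<integral>x. 1/2 * g x + 1/2 * g (a + b - x) + 1/2 * \<bar>g (a + b - x) - g x\<bar> \<partial>?M)"
  proof (rule integral_mono)
    fix x assume "x \<in> space ?M"
    then have "x \<in> {a..b}" "a + b - x \<in> {a..b}" by auto
    then have "g ((x + (a + b - x)) / 2) \<le> max (g x) (g (a + b - x))"
      using J unfolding J_quasi_convex_on_def by blast
    then have "g ((a + b) / 2) \<le> max (g x) (g (a + b - x))" by simp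
    also have "\<dots> = 1/2 * g x + 1/2 * g (a + b - x) + 1/2 * \<bar>g (a + b - x) - g x\<bar>"
      by (simp add: max_def abs_if field_simps)
    finally show "g ((a + b) / 2) \<le> 1/2 * g x + 1/2 * g (a + b - x) + 1/2 * \<bar>g (a + b - x) - g x\<bar>" .
  qed (use g r in auto)
  also have "\<dots> = (\<integral>x. g x \<partial>?M) + 1/2 * (\<integral>x. \<bar>g (a + b - x) - g x\<bar> \<partial>?M)"
    using g r reflection_integral_Icc(1)[where g = g] by simp
  finally have "g ((a + b) / 2)
      \<le> ((\<integral>x. g x \<partial>?M) + 1/2 * (\<integral>x. \<bar>g (a + b - x) - g x\<bar> \<partial>?M)) / (b - a)"
    using \<open>a < b\<close> by (simp add: pos_le_divide_eq mult.commute)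
  also have "\<dots> = 1 / (b - a) * (\<integral>x. g x \<partial>?M)
      + 1 / 2 * (1 / (b - a) * (\<integral>x. \<bar>g (a + b - x) - g x\<bar> \<partial>?M))"
    by (simp add: add_divide_distrib)
  finally show ?thesis
    by (simp only: symmetric_difference_integral_rescale[OF \<open>a < b\<close>])
qed

text \<open>The one-dimensional inequality on the section at \<open>x\<close>, integrated over \<open>x\<close>. The integrable version
  \<open>F\<close> and its reflection \<open>G\<close> in the line \<open>y = (c + d) / 2\<close> supply the integrability in \<open>x\<close> of both
  terms on the right.\<close>

lemma J_quasi_convex_midpoint_line_le:
  fixes f F :: "real \<times> real \<Rightarrow> real"
  assumes "a < b" "c < d"
    and F: "integrable (lebesgue_on {a..b} \<Otimes>\<^sub>M lebesgue_on {c..d}) F"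
    and FF: "AE x in lebesgue_on {a..b}. AE y in lebesgue_on {c..d}. F (x, y) = f (x, y)"
    and J: "\<And>x. x \<in> {a..b} \<Longrightarrow> J_quasi_convex_on {c..d} (\<lambda>y. f (x, y))"
    and ix: "\<And>x. x \<in> {a..b} \<Longrightarrow> integrable (lebesgue_on {c..d}) (\<lambda>y. f (x, y))"
    and im: "integrable (lebesgue_on {a..b}) (\<lambda>x. f (x, (c + d) / 2))"
  shows "1 / (b - a) * (\<integral>x. f (x, (c + d) / 2) \<partial>lebesgue_on {a..b})
     \<le> 1 / ((b - a) * (d - c)) * integral\<^sup>L (lebesgue_on {a..b} \<Otimes>\<^sub>M lebesgue_on {c..d}) F
       + 1 / (2 * (b - a)) * (\<integral>x. (LINT t:{0..1}|lebesgue.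
            \<bar>f (x, t * c + (1 - t) * d) - f (x, (1 - t) * c + t * d)\<bar>) \<partial>lebesgue_on {a..b})"
proof -
  let ?A = "lebesgue_on {a..b}" and ?B = "lebesgue_on {c..d}"
  interpret pair_sigma_finite ?A ?B by (rule pair_sigma_finite_lebesgue_on)
  define I where "I x = (LINT t:{0..1}|lebesgue. \<bar>f (x, t * c + (1 - t) * d) - f (x, (1 - t) * c + t * d)\<bar>)" for x
  define G where "G = (\<lambda>z. F (fst z, c + d - snd z))"
  have [measurable]: "F \<in> borel_measurable (?A \<Otimes>\<^sub>M ?B)" using F by auto
  have [measurable]: "(\<lambda>y. c + d - y) \<in> ?B \<rightarrow>\<^sub>M ?B" by (rule reflection_measurable_Icc)
  have G: "integrable (?A \<Otimes>\<^sub>M ?B) G"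
  proof (rule Fubini_integrable)
    \<comment> \<open>Reflection preserves the integral over each section, hence also the integral over the rectangle.\<close>
    show "G \<in> borel_measurable (?A \<Otimes>\<^sub>M ?B)" unfolding G_def by measurable
    have "(\<integral>y. norm (G (x, y)) \<partial>?B) = (\<integral>y. norm (F (x, y)) \<partial>?B)" for x
      using reflection_integral_Icc(1)[where g = "\<lambda>y. norm (F (x, y))"] by (simp add: G_def)
    then show "integrable ?A (\<lambda>x. \<integral>y. norm (G (x, y)) \<partial>?B)"
      using integrable_fst'[OF integrable_norm[OF F]] by simp
    show "AE x in ?A. integrable ?B (\<lambda>y. G (x, y))"
      using AE_integrable_fst'[OF F]
      by eventually_elim (drule reflection_integral_Icc(2), simp add: G_def)
  qed
  then have "integrable (?A \<Otimes>\<^sub>M ?B) (\<lambda>z. \<bar>G z - F z\<bar>)" using F by auto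
  from integrable_fst'[OF this] have K: "integrable ?A (\<lambda>x. 1 / (d - c) * (\<integral>y. \<bar>G (x, y) - F (x, y)\<bar> \<partial>?B))"
    by simp
  have eqs: "(\<integral>y. f (x, y) \<partial>?B) = (\<integral>y. F (x, y) \<partial>?B)
      \<and> I x = 1 / (d - c) * (\<integral>y. \<bar>G (x, y) - F (x, y)\<bar> \<partial>?B)"
    if x: "x \<in> {a..b}" and int: "integrable ?B (\<lambda>y. F (x, y))" and eq: "AE y in ?B. F (x, y) = f (x, y)" for x
  proof
    show "(\<integral>y. f (x, y) \<partial>?B) = (\<integral>y. F (x, y) \<partial>?B)"
      using int eq by (intro lebesgue_on_integral_cong_AE(2)) auto
    from eq have "AE y in lebesgue. y \<in> {c..d} \<longrightarrow> F (x, y) = f (x, y)"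
      by (simp add: AE_restrict_space_iff)
    from AE_reflection[OF this, of "c + d"] have "AE y in ?B. F (x, c + d - y) = f (x, c + d - y)"
      by (simp add: AE_restrict_space_iff conj_commute)
    with eq have "AE y in ?B. \<bar>f (x, c + d - y) - f (x, y)\<bar> = \<bar>G (x, y) - F (x, y)\<bar>"
      by eventually_elim (simp add: G_def)
    moreover have "integrable ?B (\<lambda>y. \<bar>G (x, y) - F (x, y)\<bar>)"
      using int reflection_integral_Icc(2)[OF int] by (simp add: G_def)
    ultimately have "(\<integral>y. \<bar>f (x, c + d - y) - f (x, y)\<bar> \<partial>?B) = (\<integral>y. \<bar>G (x, y) - F (x, y)\<bar> \<partial>?B)"
      by (intro lebesgue_on_integral_cong_AE(2))
    then show "I x = 1 / (d - c) * (\<integral>y. \<bar>G (x, y) - F (x, y)\<bar> \<partial>?B)"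
      unfolding I_def using symmetric_difference_integral_rescale[OF \<open>c < d\<close>, of "\<lambda>y. f (x, y)"] by simp
  qed
  have AE_eqs: "AE x in ?A. (\<integral>y. f (x, y) \<partial>?B) = (\<integral>y. F (x, y) \<partial>?B)
      \<and> I x = 1 / (d - c) * (\<integral>y. \<bar>G (x, y) - F (x, y)\<bar> \<partial>?B)"
    using FF AE_integrable_fst'[OF F] AE_space by eventually_elim (use eqs in simp)
  have I: "integrable ?A I"
    using K by (rule lebesgue_on_integral_cong_AE(1)) (use AE_eqs in auto)
  have eq: "AE x in ?A. (\<integral>y. f (x, y) \<partial>?B) = (\<integral>y. F (x, y) \<partial>?B)" using AE_eqs by auto
  note inner = lebesgue_on_integral_cong_AE[OF integrable_fst'[OF F] eq]
  have "(\<integral>x. f (x, (c + d) / 2) \<partial>?A) \<le> (\<integral>x. 1 / (d - c) * (\<integral>y. f (x, y) \<partial>?B) + 1/2 * I x \<partial>?A)"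
  proof (rule integral_mono)
    show "integrable ?A (\<lambda>x. 1 / (d - c) * (\<integral>y. f (x, y) \<partial>?B) + 1/2 * I x)"
      using inner(1) I by simp
    fix x assume "x \<in> space ?A"
    then have x: "x \<in> {a..b}" by simp
    show "f (x, (c + d) / 2) \<le> 1 / (d - c) * (\<integral>y. f (x, y) \<partial>?B) + 1/2 * I x"
      unfolding I_def by (rule J_quasi_convex_midpoint_le[OF \<open>c < d\<close> J[OF x] ix[OF x]])
  qed (rule im)
  also have "\<dots> = 1 / (d - c) * integral\<^sup>L (?A \<Otimes>\<^sub>M ?B) F + 1/2 * (\<integral>x. I x \<partial>?A)"
    using inner I integral_fst'[OF F] by simp
  finally have "1 / (b - a) * (\<integral>x. f (x, (c + d) / 2) \<partial>?A)
      \<le> 1 / (b - a) * (1 / (d - c) * integral\<^sup>L (?A \<Otimes>\<^sub>M ?B) F + 1/2 * (\<integral>x. I x \<partial>?A))"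
    using \<open>a < b\<close> by (intro mult_left_mono) auto
  also have "\<dots> = 1 / ((b - a) * (d - c)) * integral\<^sup>L (?A \<Otimes>\<^sub>M ?B) F + 1 / (2 * (b - a)) * (\<integral>x. I x \<partial>?A)"
    by (simp only: distrib_left mult.assoc[symmetric] times_divide_times_eq mult_1 mult.commute[of "b - a" 2])
  finally show ?thesis unfolding I_def .
qed

text \<open>The two coordinates play the same role except in the hypothesis on the iterated integral, whose
  outer variable is \<open>y\<close>. Integrability is therefore proved for the transpose \<open>F'\<close> and carried over to
  \<open>F\<close>.\<close>

theorem theorem6:
  fixes a b c d :: real and f :: "real \<times> real \<Rightarrow> real"
  assumes "a < b" and "c < d"
    and "J_quasi_convex_on_coords a b c d f"
    and "\<And>x. x \<in> {a..b} \<Longrightarrow> (\<lambda>v. f (x, v)) absolutely_integrable_on {c..d}"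
    and "\<And>y. y \<in> {c..d} \<Longrightarrow> (\<lambda>u. f (u, y)) absolutely_integrable_on {a..b}"
    and "(\<lambda>y. LINT x:{a..b}|lebesgue. f (x, y)) absolutely_integrable_on {c..d}"
  shows
    "1 / 2 * (1 / (b - a) * (LINT x:{a..b}|lebesgue. f (x, (c + d) / 2))
            + 1 / (d - c) * (LINT y:{c..d}|lebesgue. f ((a + b) / 2, y)))
     \<le> 1 / ((b - a) * (d - c)) * (LINT y:{c..d}|lebesgue. LINT x:{a..b}|lebesgue. f (x, y))
       + (1 / (4 * (d - c)) *
            (LINT y:{c..d}|lebesgue. LINT t:{0..1}|lebesgue.
               \<bar>f (t * a + (1 - t) * b, y) - f ((1 - t) * a + t * b, y)\<bar>)
        + 1 / (4 * (b - a)) *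
            (LINT x:{a..b}|lebesgue. LINT t:{0..1}|lebesgue.
               \<bar>f (x, t * c + (1 - t) * d) - f (x, (1 - t) * c + t * d)\<bar>))"
proof -
  let ?A = "lebesgue_on {a..b}" and ?B = "lebesgue_on {c..d}"
  let ?f' = "\<lambda>z. f (snd z, fst z)"
  interpret pair_sigma_finite ?A ?B by (rule pair_sigma_finite_lebesgue_on)
  interpret swap: pair_sigma_finite ?B ?A by (rule pair_sigma_finite_lebesgue_on)
  have Jx: "\<And>x. x \<in> {a..b} \<Longrightarrow> J_quasi_convex_on {c..d} (\<lambda>y. f (x, y))"
    and Jy: "\<And>y. y \<in> {c..d} \<Longrightarrow> J_quasi_convex_on {a..b} (\<lambda>x. f (x, y))"
    using assms(3) by (auto simp: J_quasi_convex_on_coords_def)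
  have ix: "\<And>x. x \<in> {a..b} \<Longrightarrow> integrable ?B (\<lambda>y. f (x, y))"
    and iy: "\<And>y. y \<in> {c..d} \<Longrightarrow> integrable ?A (\<lambda>x. f (x, y))"
    using assms(4,5) by (simp_all only: integrable_lebesgue_on_Icc)
  have ii: "integrable ?B (\<lambda>y. \<integral>x. f (x, y) \<partial>?A)"
    using assms(6) by (simp only: integrable_lebesgue_on_Icc set_lebesgue_integral_Icc)
  obtain F where F: "F \<in> borel_measurable (?A \<Otimes>\<^sub>M ?B)"
    and Fx: "AE x in ?A. AE y in ?B. F (x, y) = f (x, y)"
    and Fy: "AE y in ?B. AE x in ?A. F (x, y) = f (x, y)"
    using jointly_measurable_version[of a b c d f, OF Jx Jy] ix iy by blast
  define F' where "F' = (\<lambda>(y, x). F (x, y))"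
  have F': "F' \<in> borel_measurable (?B \<Otimes>\<^sub>M ?A)"
    using measurable_pair_swap[OF F] by (simp add: F'_def)
  have int': "integrable (?B \<Otimes>\<^sub>M ?A) F'"
    using \<open>a < b\<close> F' Fx Fy Jy iy ix ii
    by (intro jointly_measurable_version_integrable[where f = ?f']) (simp_all add: F'_def)
  have int: "integrable (?A \<Otimes>\<^sub>M ?B) F"
    using int' integrable_product_swap_iff[of F] by (simp add: F'_def)
  have "integral\<^sup>L (?B \<Otimes>\<^sub>M ?A) F' = (\<integral>y. (\<integral>x. F' (y, x) \<partial>?A) \<partial>?B)"
    using swap.integral_fst'[OF int'] by simp
  also have "\<dots> = (\<integral>y. (\<integral>x. f (x, y) \<partial>?A) \<partial>?B)"
  proof (intro integral_cong_AE)
    show "AE y in ?B. (\<integral>x. F' (y, x) \<partial>?A) = (\<integral>x. f (x, y) \<partial>?A)"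
      using Fy AE_space
    proof eventually_elim
      case (elim y)
      then show ?case
        using iy[of y] by (intro lebesgue_on_integral_cong_AE(2)) (auto simp: F'_def)
    qed
  qed (use swap.integrable_fst'[OF int'] ii in auto)
  finally have eq': "integral\<^sup>L (?B \<Otimes>\<^sub>M ?A) F' = (\<integral>y. (\<integral>x. f (x, y) \<partial>?A) \<partial>?B)" .
  have eq: "integral\<^sup>L (?A \<Otimes>\<^sub>M ?B) F = (\<integral>y. (\<integral>x. f (x, y) \<partial>?A) \<partial>?B)"
    using integral_product_swap[OF F] eq' by (simp add: F'_def)
  have mid: "(a + b) / 2 \<in> {a..b}" "(c + d) / 2 \<in> {c..d}" using assms(1,2) by auto
  have h1: "1 / (b - a) * (\<integral>x. f (x, (c + d) / 2) \<partial>?A)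
     \<le> 1 / ((b - a) * (d - c)) * (\<integral>y. (\<integral>x. f (x, y) \<partial>?A) \<partial>?B)
       + 1 / (2 * (b - a)) * (\<integral>x. (LINT t:{0..1}|lebesgue.
            \<bar>f (x, t * c + (1 - t) * d) - f (x, (1 - t) * c + t * d)\<bar>) \<partial>?A)"
    using J_quasi_convex_midpoint_line_le[OF assms(1,2) int Fx Jx ix iy[OF mid(2)]]
    unfolding eq by simp
  have h2: "1 / (d - c) * (\<integral>y. f ((a + b) / 2, y) \<partial>?B)
     \<le> 1 / ((d - c) * (b - a)) * (\<integral>y. (\<integral>x. f (x, y) \<partial>?A) \<partial>?B)
       + 1 / (2 * (d - c)) * (\<integral>y. (LINT t:{0..1}|lebesgue.
            \<bar>f (t * a + (1 - t) * b, y) - f ((1 - t) * a + t * b, y)\<bar>) \<partial>?B)"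
    using J_quasi_convex_midpoint_line_le[OF assms(2,1) int', of ?f'] Fy Jy iy ix[OF mid(1)]
    unfolding eq' by (simp add: F'_def)
  have average: "1 / 2 * (p + q) \<le> S + (1 / 2 * Y + 1 / 2 * X)" if "p \<le> S + X" "q \<le> S + Y" for p q S X Y :: real
    using that by simp
  \<comment> \<open>This exposes the right-hand side as the mean of those of \<open>h1\<close> and \<open>h2\<close>.\<close>
  have halve: "1 / (4 * u) * X = 1 / 2 * (1 / (2 * u) * X)" for u X :: real by simp
  show ?thesis
    unfolding set_lebesgue_integral_Icc[of a b] set_lebesgue_integral_Icc[of c d] halve
    using h1 h2[unfolded mult.commute[of "d - c" "b - a"]] by (rule average)
qed

end
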